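(* In the setting described in the context, let $f(x,y,z,w_j,s,t,r_k)=0$ be the equation in Cox coordinates of the general anticanonical $K3$ hypersurface $V$ in $X$. Then $f_{|z=0}$ does not depend on the coordinates $(s,t)$ if and only if $v_z$ is an interior point of an edge of $\nabla$ with vertices $v_s$ and $v_t$.
   Context: $N\simeq\mathbb{Z}^3$ and $M$ are dual lattices; $\nabla\subset N_{\mathbb{R}}$ is a reflexive $3$-dimensional polytope with (reflexive) dual $\Delta\subset M_{\mathbb{R}}$, containing a $2$-dimensional reflexive polytope $\nabla^\varphi=\nabla\cap N_{\varphi,\mathbb{R}}$ with $N_\varphi\subset N$ a rank $2$ sublattice. $X$ is the toric variety of a projective simplicial refinement of the fan over the faces of $\nabla$, such that $N\to N/N_\varphi\simeq \mathbb{Z}$ induces a toric fibration $\phi:X\to\mathbb{P}^1$. The Cox coordinates are: $x,y,z,w_j$, corresponding to the vertices $v_x,v_y,v_z,v_{w_j}$ of $\nabla^\varphi$ (there may be no $w_j$, or $j\in\{1,2,3\}$); and $s,t,r_k$, corresponding to the remaining vertices of $\nabla$, where $v_s$ and $v_t$ are the unit lattice points along the edges of $\nabla$ through $v_z$ such that their images in $N/N_\varphi$ span the two different one-dimensional cones of the fan of $\mathbb{P}^1$. It is assumed that the toric divisor $D_z=\{z=0\}$ restricts to a section of the elliptic fibration $V\to\mathbb{P}^1$. The equation of the general $V\in|-K_X|$ is $f=\sum_{m\in\Delta\cap M}a_m\prod_i z_i^{\langle m,v_i\rangle+1}=0$, where the product is over all Cox coordinates $z_i$ with rays $v_i$ and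 the $a_m$ are generic complex coefficients. *)

theory Defs
  imports "HOL-Analysis.Analysis"
begin

section \<open>Lattices and reflexive polytopes\<close>

text \<open>
  The dual of the real vector space spanned by a lattice \<open>L\<close> is identified with \<open>span L\<close>
  itself by means of the inner product.
\<close>

definition lat_N :: "(real^3) set" where
  "lat_N = {v. \<forall>i. v $ i \<in> \<int>}"

definition dual_lattice :: "(real^3) set \<Rightarrow> (real^3) set" where
  "dual_lattice L = {m \<in> span L. \<forall>v\<in>L. m \<bullet> v \<in> \<int>}"

abbreviation lat_M :: "(real^3) set" where
  "lat_M \<equiv> dual_lattice lat_N"

definition polar_dual :: "(real^3) set \<Rightarrow> (real^3) set \<Rightarrow> (real^3) set" where
  "polar_dual L P = {m \<in> span L. \<forall>v\<in>P. m \<bullet> v \<ge> -1}"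

definition lattice_polytope :: "(real^3) set \<Rightarrow> (real^3) set \<Rightarrow> bool" where
  "lattice_polytope L P \<longleftrightarrow> (\<exists>S. finite S \<and> S \<subseteq> L \<and> P = convex hull S)"

definition reflexive_polytope :: "(real^3) set \<Rightarrow> (real^3) set \<Rightarrow> bool" where
  "reflexive_polytope L P \<longleftrightarrow>
     lattice_polytope L P \<and> affine hull P = span L \<and> 0 \<in> rel_interior P \<and>
     lattice_polytope (dual_lattice L) (polar_dual L P)"

definition vertices :: "(real^3) set \<Rightarrow> (real^3) set" where
  "vertices P = {v. v extreme_point_of P}"


section \<open>Fans\<close>

definition rational_cone :: "(real^3) set \<Rightarrow> bool" where
  "rational_cone \<sigma> \<longleftrightarrow>
     (\<exists>S. finite S \<and> S \<subseteq> lat_N \<and> \<sigma> = convex_cone hull S) \<and> \<sigma> \<inter> uminus ` \<sigma> = {0}"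

definition fan :: "(real^3) set set \<Rightarrow> bool" where
  "fan \<Sigma> \<longleftrightarrow>
     finite \<Sigma> \<and> \<Sigma> \<noteq> {} \<and> (\<forall>\<sigma>\<in>\<Sigma>. rational_cone \<sigma>) \<and>
     (\<forall>\<sigma>\<in>\<Sigma>. \<forall>\<tau>. \<tau> face_of \<sigma> \<and> \<tau> \<noteq> {} \<longrightarrow> \<tau> \<in> \<Sigma>) \<and>
     (\<forall>\<sigma>\<in>\<Sigma>. \<forall>\<tau>\<in>\<Sigma>. \<sigma> \<inter> \<tau> face_of \<sigma> \<and> \<sigma> \<inter> \<tau> face_of \<tau>)"

definition simplicial_fan :: "(real^3) set set \<Rightarrow> bool" where
  "simplicial_fan \<Sigma> \<longleftrightarrow> fan \<Sigma> \<and> (\<forall>\<sigma>\<in>\<Sigma>. \<exists>S. independent S \<and> \<sigma> = convex_cone hull S)"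

text \<open>The cone over the empty face is \<open>{0}\<close>.\<close>

definition face_fan :: "(real^3) set \<Rightarrow> (real^3) set set" where
  "face_fan P = {convex_cone hull F | F. F face_of P \<and> F \<noteq> P}"

definition refines_fan :: "(real^3) set set \<Rightarrow> (real^3) set set \<Rightarrow> bool" where
  "refines_fan \<Sigma> \<Sigma>' \<longleftrightarrow> (\<forall>\<sigma>\<in>\<Sigma>. \<exists>\<tau>\<in>\<Sigma>'. \<sigma> \<subseteq> \<tau>) \<and> \<Union>\<Sigma> = \<Union>\<Sigma>'"

text \<open>Existence of an integral strictly convex support function (on a complete fan).\<close>

definition projective_fan :: "(real^3) set set \<Rightarrow> bool" where
  "projective_fan \<Sigma> \<longleftrightarrow>
     \<Union>\<Sigma> = UNIV \<and>
     (\<exists>\<psi> :: real^3 \<Rightarrow> real. \<forall>\<sigma>\<in>\<Sigma>. aff_dim \<sigma> = 3 \<longrightarrow>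
        (\<exists>m\<in>lat_M. (\<forall>v\<in>\<sigma>. \<psi> v = m \<bullet> v) \<and> (\<forall>v. v \<notin> \<sigma> \<longrightarrow> \<psi> v > m \<bullet> v)))"

text \<open>\<open>R\<close> consists of one generator for each ray of the fan.\<close>

definition has_rays :: "(real^3) set set \<Rightarrow> (real^3) set \<Rightarrow> bool" where
  "has_rays \<Sigma> R \<longleftrightarrow> {\<rho>\<in>\<Sigma>. aff_dim \<rho> = 1} = (\<lambda>v. convex_cone hull {v}) ` R"

text \<open>
  The projection is \<open>v \<mapsto> n \<bullet> v\<close>; every cone has to be mapped into one of the cones
  \<open>[0,\<infinity>)\<close>, \<open>(-\<infinity>,0]\<close> of the fan of the projective line.
\<close>

definition fibred_over_P1 :: "(real^3) set set \<Rightarrow> real^3 \<Rightarrow> bool" where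
  "fibred_over_P1 \<Sigma> n \<longleftrightarrow> (\<forall>\<sigma>\<in>\<Sigma>. (\<forall>v\<in>\<sigma>. n \<bullet> v \<ge> 0) \<or> (\<forall>v\<in>\<sigma>. n \<bullet> v \<le> 0))"


section \<open>The toric variety as a Cox quotient\<close>

text \<open>
  Cox coordinates are indexed by the ray generators: a point of the Cox affine space is a
  function on \<open>R\<close>.  For a simplicial fan the points of the toric variety are the orbits of
  \<open>Hom (Cl X, \<complex>\<^sup>*)\<close> on the complement of the irrelevant locus.
\<close>

type_synonym cox_point = "real^3 \<Rightarrow> complex"

definition cox_domain :: "(real^3) set set \<Rightarrow> (real^3) set \<Rightarrow> cox_point set" where
  "cox_domain \<Sigma> R = {p \<in> R \<rightarrow>\<^sub>E UNIV. \<exists>\<sigma>\<in>\<Sigma>. \<forall>v\<in>R. v \<notin> \<sigma> \<longrightarrow> p v \<noteq> 0}"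

definition character :: "(real^3) set \<Rightarrow> real^3 \<Rightarrow> cox_point \<Rightarrow> complex" where
  "character R m p = (\<Prod>v\<in>R. p v powi \<lfloor>m \<bullet> v\<rfloor>)"

definition cox_group :: "(real^3) set \<Rightarrow> cox_point set" where
  "cox_group R = {g. (\<forall>v\<in>R. g v \<noteq> 0) \<and> (\<forall>m\<in>lat_M. character R m g = 1)}"

definition cox_rel :: "(real^3) set set \<Rightarrow> (real^3) set \<Rightarrow> (cox_point \<times> cox_point) set" where
  "cox_rel \<Sigma> R = {(p, q). p \<in> cox_domain \<Sigma> R \<and> q \<in> cox_domain \<Sigma> R \<and>
     (\<exists>g\<in>cox_group R. \<forall>v\<in>R. q v = g v * p v)}"

definition toric_variety :: "(real^3) set set \<Rightarrow> (real^3) set \<Rightarrow> cox_point set set" where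
  "toric_variety \<Sigma> R = cox_domain \<Sigma> R // cox_rel \<Sigma> R"

definition affine_chart ::
  "(real^3) set set \<Rightarrow> (real^3) set \<Rightarrow> (real^3) set \<Rightarrow> cox_point set set" where
  "affine_chart \<Sigma> R \<sigma> = {c \<in> toric_variety \<Sigma> R. \<forall>p\<in>c. \<forall>v\<in>R. v \<notin> \<sigma> \<longrightarrow> p v \<noteq> 0}"

definition toric_divisor ::
  "(real^3) set set \<Rightarrow> (real^3) set \<Rightarrow> real^3 \<Rightarrow> cox_point set set" where
  "toric_divisor \<Sigma> R v = {c \<in> toric_variety \<Sigma> R. \<forall>p\<in>c. p v = 0}"

text \<open>The exponents \<open>m \<bullet> v + 1\<close> are non-negative integers for \<open>m\<close> in \<open>\<Delta> \<inter> M\<close>.\<close>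

definition anticanonical_eq ::
  "(real^3) set \<Rightarrow> (real^3) set \<Rightarrow> (real^3 \<Rightarrow> complex) \<Rightarrow> cox_point \<Rightarrow> complex" where
  "anticanonical_eq \<Delta> R a p =
     (\<Sum>m\<in>\<Delta> \<inter> lat_M. a m * (\<Prod>v\<in>R. p v ^ nat \<lfloor>m \<bullet> v + 1\<rfloor>))"

definition anticanonical_hypersurface ::
  "(real^3) set set \<Rightarrow> (real^3) set \<Rightarrow> (real^3) set \<Rightarrow> (real^3 \<Rightarrow> complex) \<Rightarrow> cox_point set set"
  where
  "anticanonical_hypersurface \<Sigma> R \<Delta> a =
     {c \<in> toric_variety \<Sigma> R. \<forall>p\<in>c. anticanonical_eq \<Delta> R a p = 0}"


section \<open>The fibration over the projective line and its sections\<close>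

definition proj1 :: "complex \<times> complex \<Rightarrow> (complex \<times> complex) set" where
  "proj1 u = {(c * fst u, c * snd u) | c. c \<noteq> 0}"

definition P1 :: "(complex \<times> complex) set set" where
  "P1 = proj1 ` (UNIV - {(0, 0)})"

text \<open>
  The homogeneous coordinates of the image are the two Cox coordinates of the projective line
  pulled back along \<open>v \<mapsto> n \<bullet> v\<close>.  The result does not depend on the representative \<open>p\<close>, so
  the union is over equal sets.
\<close>

definition toric_fibration ::
  "(real^3) set \<Rightarrow> real^3 \<Rightarrow> cox_point set \<Rightarrow> (complex \<times> complex) set" where
  "toric_fibration R n c =
     (\<Union>p\<in>c. proj1 (\<Prod>v\<in>{v\<in>R. n \<bullet> v > 0}. p v ^ nat \<lfloor>n \<bullet> v\<rfloor>,
                   \<Prod>v\<in>{v\<in>R. n \<bullet> v < 0}. p v ^ nat \<lfloor>- (n \<bullet> v)\<rfloor>))"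

definition binary_form :: "nat \<Rightarrow> (nat \<Rightarrow> complex) \<Rightarrow> complex \<times> complex \<Rightarrow> complex" where
  "binary_form d c u = (\<Sum>i\<le>d. c i * fst u ^ i * snd u ^ (d - i))"

text \<open>
  Morphisms of varieties from the projective line: near each point the map lands in an affine
  chart, whose coordinate ring is spanned by the characters \<open>m \<in> \<sigma>\<^sup>\<or> \<inter> M\<close>, and the pullbacks of
  these are regular, i.e. quotients of binary forms of equal degree with non-vanishing
  denominator.  Zariski neighbourhoods on the line are the cofinite sets.
\<close>

definition morphism_from_P1 ::
  "(real^3) set set \<Rightarrow> (real^3) set \<Rightarrow> ((complex \<times> complex) set \<Rightarrow> cox_point set) \<Rightarrow> bool" where
  "morphism_from_P1 \<Sigma> R g \<longleftrightarrow>
     (\<forall>x\<in>P1. \<exists>\<sigma>\<in>\<Sigma>. \<exists>W. x \<in> W \<and> W \<subseteq> P1 \<and> finite (P1 - W) \<and> g ` W \<subseteq> affine_chart \<Sigma> R \<sigma> \<and>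
        (\<forall>m\<in>lat_M. (\<forall>v\<in>\<sigma>. m \<bullet> v \<ge> 0) \<longrightarrow>
           (\<exists>d b e. \<forall>u. u \<noteq> (0, 0) \<and> proj1 u \<in> W \<longrightarrow>
              binary_form d e u \<noteq> 0 \<and>
              (\<forall>p\<in>g (proj1 u). character R m p = binary_form d b u / binary_form d e u))))"

definition is_section ::
  "(real^3) set set \<Rightarrow> (real^3) set \<Rightarrow> real^3 \<Rightarrow> cox_point set set \<Rightarrow>
   ((complex \<times> complex) set \<Rightarrow> cox_point set) \<Rightarrow> bool" where
  "is_section \<Sigma> R n V g \<longleftrightarrow>
     morphism_from_P1 \<Sigma> R g \<and> (\<forall>x\<in>P1. g x \<in> V \<and> toric_fibration R n (g x) = x)"

definition divisor_restricts_to_section ::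
  "(real^3) set set \<Rightarrow> (real^3) set \<Rightarrow> real^3 \<Rightarrow> cox_point set set \<Rightarrow> real^3 \<Rightarrow> bool" where
  "divisor_restricts_to_section \<Sigma> R n V v \<longleftrightarrow>
     (\<exists>g. is_section \<Sigma> R n V g \<and> toric_divisor \<Sigma> R v \<inter> V = g ` P1)"


section \<open>Generic coefficients and independence of coordinates\<close>

inductive_set polynomial_functions :: "'i set \<Rightarrow> (('i \<Rightarrow> complex) \<Rightarrow> complex) set"
  for I :: "'i set" where
  const: "(\<lambda>a. c) \<in> polynomial_functions I"
| coord: "i \<in> I \<Longrightarrow> (\<lambda>a. a i) \<in> polynomial_functions I"
| add: "g \<in> polynomial_functions I \<Longrightarrow> h \<in> polynomial_functions I \<Longrightarrow>
        (\<lambda>a. g a + h a) \<in> polynomial_functions I"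
| mult: "g \<in> polynomial_functions I \<Longrightarrow> h \<in> polynomial_functions I \<Longrightarrow>
        (\<lambda>a. g a * h a) \<in> polynomial_functions I"

text \<open>\<open>Q\<close> holds on a non-empty Zariski open subset of the space of coefficients \<open>(a\<^sub>i)\<^sub>i\<^sub>\<in>\<^sub>I\<close>.\<close>

definition for_generic :: "'i set \<Rightarrow> (('i \<Rightarrow> complex) \<Rightarrow> bool) \<Rightarrow> bool" where
  "for_generic I Q \<longleftrightarrow>
     (\<exists>h\<in>polynomial_functions I. (\<exists>a. h a \<noteq> 0) \<and> (\<forall>a. h a \<noteq> 0 \<longrightarrow> Q a))"

definition restrict_to_zero :: "real^3 \<Rightarrow> (cox_point \<Rightarrow> complex) \<Rightarrow> cox_point \<Rightarrow> complex" where
  "restrict_to_zero v f = (\<lambda>p. f (p(v := 0)))"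

definition independent_of_coords ::
  "(real^3) set \<Rightarrow> (real^3) set \<Rightarrow> (cox_point \<Rightarrow> complex) \<Rightarrow> bool" where
  "independent_of_coords R S f \<longleftrightarrow> (\<forall>p q. (\<forall>v\<in>R - S. p v = q v) \<longrightarrow> f p = f q)"

end

theory Submission
  imports Defs
begin

text \<open>
  A monomial of \<open>f\<close> survives on \<open>z = 0\<close> iff its exponent \<open>m\<close> lies on the face of \<open>\<Delta>\<close> dual to \<open>v_z\<close>,
  and it is free of \<open>s\<close> and \<open>t\<close> iff also \<open>m \<bullet> v_s = m \<bullet> v_t = -1\<close>.  If \<open>v_z\<close> is interior to the edge
  from \<open>v_s\<close> to \<open>v_t\<close>, the first condition implies the second one.  Otherwise \<open>v_z\<close> is a vertex of
  \<open>\<nabla>\<close>; a functional exposing it lies on the dual face of \<open>v_z\<close> but not on that of \<open>v_s\<close>, and as \<open>\<Delta>\<close>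
  is a lattice polytope some lattice point does the same.  Its monomial involves \<open>s\<close>.
\<close>

section \<open>Lattice points and lattice polytopes\<close>

lemma span_lat_N: "span lat_N = UNIV"
proof -
  have "Basis \<subseteq> lat_N"
    by (auto simp: lat_N_def Basis_vec_def axis_def)
  then show ?thesis
    using span_mono[of Basis lat_N] by auto
qed

lemma inner_lattice_Ints: "m \<in> dual_lattice L \<Longrightarrow> v \<in> L \<Longrightarrow> m \<bullet> v \<in> \<int>"
  by (simp add: dual_lattice_def)

lemma lat_M_component_Ints:
  assumes "m \<in> lat_M"
  shows "m $ i \<in> \<int>"
proof -
  have "axis i 1 \<in> lat_N"
    by (auto simp: lat_N_def axis_def)
  with assms have "m \<bullet> axis i 1 \<in> \<int>"
    by (rule inner_lattice_Ints)
  then show ?thesis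
    by (simp add: inner_axis)
qed

text \<open>Points of \<open>lat_M\<close> have integer coordinates, and boundedness leaves finitely
  many values for each. Applied to \<open>Delta\<close>, this makes the sum in
  \<open>anticanonical_eq\<close> genuinely finite; over an infinite index set it would default to
  0.\<close>

lemma finite_bounded_Int_lat_M:
  assumes "bounded D"
  shows "finite (D \<inter> lat_M)"
proof -
  from assms obtain B where B: "\<And>m. m \<in> D \<Longrightarrow> norm m \<le> B"
    by (auto simp: bounded_iff)
  define K where "K = {k::real. k \<in> \<int> \<and> \<bar>k\<bar> \<le> B}"
  have K: "finite K"
    unfolding K_def by (rule finite_abs_int_segment)
  have "D \<inter> lat_M \<subseteq> vec_lambda ` (UNIV \<rightarrow> K)"
  proof
    fix m assume "m \<in> D \<inter> lat_M"
    then have "m $ i \<in> K" for i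
      using B[of m] component_le_norm_cart[of m i] lat_M_component_Ints[of m i]
      by (auto simp: K_def)
    then show "m \<in> vec_lambda ` (UNIV \<rightarrow> K)"
      by (intro image_eqI[of _ _ "vec_nth m"]) auto
  qed
  moreover have "finite (UNIV \<rightarrow> K :: (3 \<Rightarrow> real) set)"
    using finite_PiE[of "UNIV :: 3 set" "\<lambda>_. K"] K by (simp add: PiE_UNIV_domain)
  ultimately show ?thesis
    by (meson finite_imageI finite_subset)
qed

lemma lattice_polytope_imp_polytope: "lattice_polytope L P \<Longrightarrow> polytope P"
  by (auto simp: lattice_polytope_def polytope_def)

lemma vertices_lattice_polytope: "lattice_polytope L P \<Longrightarrow> vertices P \<subseteq> L"
  by (auto simp: lattice_polytope_def vertices_def dest: extreme_point_of_convex_hull)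

lemma finite_vertices_lattice_polytope: "lattice_polytope L P \<Longrightarrow> finite (vertices P)"
  unfolding vertices_def
  by (intro finite_polyhedron_extreme_points polytope_imp_polyhedron)
    (rule lattice_polytope_imp_polytope)

text \<open>Supplies the polynomial in the coefficients whose non-vanishing gives the Zariski open
  set in the dependent case.\<close>

lemma linear_form_in_polynomial_functions:
  assumes "finite J" "J \<subseteq> I"
  shows "(\<lambda>a. \<Sum>i\<in>J. a i * c i) \<in> polynomial_functions I"
  using assms
proof (induction J rule: finite_induct)
  case empty
  then show ?case
    by (simp add: polynomial_functions.const)
next
  case (insert i J)
  have "(\<lambda>a. a i * c i + (\<Sum>i\<in>J. a i * c i)) \<in> polynomial_functions I"
    using insert
    by (intro polynomial_functions.add polynomial_functions.mult
        polynomial_functions.coord polynomial_functions.const) auto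
  then show ?case
    using insert by simp
qed

section \<open>Edges of a polytope through a given point\<close>

lemma edge_of_polytope_closed_segment:
  assumes "polytope P" "E edge_of P"
  obtains a b where "a \<noteq> b" "E = closed_segment a b"
proof -
  have E: "E face_of P" "aff_dim E = 1"
    using assms by (auto simp: edge_of_def)
  then have pE: "polytope E"
    using assms face_of_polytope_polytope by blast
  have "compact E" "convex E"
    using pE polytope_imp_compact polytope_imp_convex by auto
  moreover have "collinear E"
    using E by (simp add: collinear_aff_dim)
  ultimately obtain a b where "E = closed_segment a b"
    using compact_convex_collinear_segment E by (metis aff_dim_empty neg_one_neq_one)
  moreover have "a \<noteq> b"
    using calculation E by auto
  ultimately show ?thesis
    using that by blast
qed

lemma vertices_closed_segment: "vertices (closed_segment a b) = {a, b}"
  by (auto simp: vertices_def extreme_point_of_segment)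

text \<open>The endpoints of an edge are vertices of \<open>P\<close>, so \<open>v\<close> lies in
  the relative interior of both edges. A face meeting the relative interior of another face contains
  it, which gives both inclusions.\<close>

lemma edges_through_nonvertex_eq:
  assumes P: "polytope P" and E: "E edge_of P" and E': "E' edge_of P"
    and v: "v \<in> E" "v \<in> E'" "v \<notin> vertices P"
  shows "E = E'"
proof -
  have sub: "F \<subseteq> F'" if F: "F edge_of P" "v \<in> F" and F': "F' edge_of P" "v \<in> F'" for F F'
  proof -
    obtain a b where ab: "a \<noteq> b" "F = closed_segment a b"
      using edge_of_polytope_closed_segment[OF P F(1)] by blast
    have "v \<notin> {a, b}"
      using F v(3) ab extreme_point_of_face[of F P]
      by (auto simp: edge_of_def vertices_def extreme_point_of_segment)
    then have "v \<in> rel_interior F"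
      using F ab by (simp add: open_segment_def rel_interior_closed_segment)
    then show ?thesis
      using F F' by (intro subset_of_face_of[of F' P F]) (auto simp: edge_of_def face_of_imp_subset)
  qed
  show ?thesis
    using sub E E' v by blast
qed

text \<open>The two edges coincide, and distinct vertices of \<open>P\<close> on one segment must be
  its two endpoints. Not being a vertex, \<open>v\<close> lies strictly between them.\<close>

lemma nonvertex_in_rel_interior_edge:
  assumes P: "polytope P"
    and E: "E edge_of P" "v \<in> E" "s \<in> E" and E': "E' edge_of P" "v \<in> E'" "t \<in> E'"
    and st: "s \<in> vertices P" "t \<in> vertices P" "s \<noteq> t" and v: "v \<notin> vertices P"
  shows "v \<in> rel_interior E" "vertices E = {s, t}"
proof -
  have eq: "E = E'"
    using edges_through_nonvertex_eq P E E' v by blast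
  obtain a b where ab: "a \<noteq> b" "E = closed_segment a b"
    using edge_of_polytope_closed_segment[OF P E(1)] by blast
  have face: "x \<in> vertices E \<longleftrightarrow> x \<in> vertices P" if "x \<in> E" for x
    using that E extreme_point_of_face[of E P] by (auto simp: edge_of_def vertices_def)
  have "{s, t} = {a, b}"
    using face[of s] face[of t] E E' eq st ab vertices_closed_segment[of a b] by auto
  then show "vertices E = {s, t}"
    using ab vertices_closed_segment by simp
  show "v \<in> rel_interior E"
    using face[of v] E v ab vertices_closed_segment[of a b]
    by (simp add: open_segment_def rel_interior_closed_segment)
qed

section \<open>Lattice points on the dual face of a vertex\<close>

text \<open>Faces of a polytope are exposed, so some \<open>c\<close> attains its maximum
  \<open>b\<close> over \<open>P\<close> exactly at \<open>v\<close>. Since \<open>b > 0\<close>,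
  rescaling to \<open>- c /\<^sub>R b\<close> normalises the minimum to -1.\<close>

lemma polar_dual_exposes_vertex:
  assumes P: "polytope P" and P0: "0 \<in> rel_interior P" and span: "span L = UNIV"
    and v: "v \<in> vertices P" and w: "w \<in> P" "w \<noteq> v"
  obtains u where "u \<in> polar_dual L P" "u \<bullet> v = -1" "u \<bullet> w > -1"
proof -
  have "{v} face_of P"
    using v by (simp add: vertices_def face_of_singleton)
  then have "{v} exposed_face_of P"
    using P exposed_face_of_polyhedron polytope_imp_polyhedron by blast
  then obtain c b where cb: "P \<subseteq> {x. c \<bullet> x \<le> b}" "{v} = P \<inter> {x. c \<bullet> x = b}"
    by (auto simp: exposed_face_of_def)
  have "0 \<in> P"
    using P0 rel_interior_subset by blast
  \<comment> \<open>As \<open>w\<close> shows \<open>P \<noteq> {v}\<close>, the extreme point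
    \<open>v\<close> is outside the relative interior, which contains 0. Now
    \<open>0 \<in> P\<close> gives \<open>b \<ge> 0\<close>, and \<open>b = 0\<close> would put 0 in
    \<open>{v}\<close>.\<close>
  moreover have "v \<noteq> 0"
    using extreme_point_not_in_REL_INTERIOR[of v P] v w P0 by (auto simp: vertices_def)
  ultimately have b: "b > 0"
    using cb by (force simp: order_less_le)
  have "c \<bullet> v = b" "c \<bullet> w < b"
    using cb w by (auto simp: order_less_le)
  with b have "(- c /\<^sub>R b) \<bullet> v = -1" "(- c /\<^sub>R b) \<bullet> w > -1"
    by (auto simp: field_simps)
  moreover have "- c /\<^sub>R b \<in> polar_dual L P"
    using cb(1) b span by (auto simp: polar_dual_def field_simps)
  ultimately show ?thesis
    using that by blast
qed

text \<open>Write \<open>u\<close> as a convex combination of \<open>S\<close>. The non-negative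
  terms \<open>r m * (m \<bullet> v - k)\<close> sum to 0, so every point of positive weight attains
  \<open>k\<close>; as \<open>u \<bullet> w > l\<close>, one of these points exceeds
  \<open>l\<close> on \<open>w\<close>.\<close>

lemma convex_hull_minimum_attained_off:
  fixes S :: "'a::euclidean_space set"
  assumes fin: "finite S" and u: "u \<in> convex hull S"
    and ge: "\<And>m. m \<in> S \<Longrightarrow> m \<bullet> v \<ge> k" "\<And>m. m \<in> S \<Longrightarrow> m \<bullet> w \<ge> l"
    and uv: "u \<bullet> v = k" and uw: "u \<bullet> w > l"
  obtains m where "m \<in> S" "m \<bullet> v = k" "m \<bullet> w > l"
proof -
  obtain r where r: "\<And>m. m \<in> S \<Longrightarrow> 0 \<le> r m" "sum r S = 1" "(\<Sum>m\<in>S. r m *\<^sub>R m) = u"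
    using u by (auto simp: convex_hull_finite[OF fin])
  have "(\<Sum>m\<in>S. r m * (m \<bullet> v - k)) = u \<bullet> v - k"
    using r(2) by (simp add: r(3)[symmetric] inner_sum_left right_diff_distrib sum_subtractf
        flip: sum_distrib_right)
  then have "\<forall>m\<in>S. r m * (m \<bullet> v - k) = 0"
    using uv r(1) ge(1) by (subst sum_nonneg_eq_0_iff[symmetric]) (auto simp: fin)
  moreover have "(\<Sum>m\<in>S. r m * (m \<bullet> w - l)) = u \<bullet> w - l"
    using r(2) by (simp add: r(3)[symmetric] inner_sum_left right_diff_distrib sum_subtractf
        flip: sum_distrib_right)
  then have "(\<Sum>m\<in>S. r m * (m \<bullet> w - l)) \<noteq> 0"
    using uw by simp
  then obtain m where "m \<in> S" "r m * (m \<bullet> w - l) \<noteq> 0"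
    by (meson sum.neutral)
  ultimately show ?thesis
    using that[of m] ge(2)[of m] by fastforce
qed

section \<open>Monomials of the equation restricted to a coordinate divisor\<close>

lemma restricted_anticanonical_eq_independent:
  assumes fin: "finite R" and z: "z \<in> R" "z \<in> lat_N"
    and ge: "\<And>m. m \<in> Delta \<inter> lat_M \<Longrightarrow> m \<bullet> z \<ge> -1"
    and S: "\<And>m v. m \<in> Delta \<inter> lat_M \<Longrightarrow> m \<bullet> z = -1 \<Longrightarrow> v \<in> S \<Longrightarrow> m \<bullet> v = -1"
  shows "independent_of_coords R S (restrict_to_zero z (anticanonical_eq Delta R a))"
  unfolding independent_of_coords_def restrict_to_zero_def anticanonical_eq_def
proof (intro allI impI sum.cong refl arg_cong2[where f = "(*)"])
  fix p q :: cox_point and m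
  assume pq: "\<forall>v\<in>R - S. p v = q v" and m: "m \<in> Delta \<inter> lat_M"
  show "(\<Prod>v\<in>R. (p(z := 0)) v ^ nat \<lfloor>m \<bullet> v + 1\<rfloor>) = (\<Prod>v\<in>R. (q(z := 0)) v ^ nat \<lfloor>m \<bullet> v + 1\<rfloor>)"
  proof (cases "m \<bullet> z = -1")
    case True
    show ?thesis
    proof (rule prod.cong[OF refl])
      fix v assume "v \<in> R"
      then show "(p(z := 0)) v ^ nat \<lfloor>m \<bullet> v + 1\<rfloor> = (q(z := 0)) v ^ nat \<lfloor>m \<bullet> v + 1\<rfloor>"
        using pq S[OF m True, of v] by (cases "v \<in> S") auto
    qed
  next
    case False
    \<comment> \<open>Integrality turns \<open>m \<bullet> z > -1\<close> into an exponent of at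
      least 1, so the monomial vanishes at both points.\<close>
    have "m \<bullet> z \<in> \<int>"
      using m z by (auto intro: inner_lattice_Ints)
    then obtain k where "m \<bullet> z = of_int k"
      by (rule Ints_cases)
    with ge[OF m] False have "nat \<lfloor>m \<bullet> z + 1\<rfloor> > 0"
      by simp
    then have "(r(z := 0)) z ^ nat \<lfloor>m \<bullet> z + 1\<rfloor> = 0" for r :: cox_point
      by simp
    then have "(\<Prod>v\<in>R. (r(z := 0)) v ^ nat \<lfloor>m \<bullet> v + 1\<rfloor>) = 0" for r :: cox_point
      using z fin by (intro prod_zero) blast+
    then show ?thesis
      by simp
  qed
qed

lemma restricted_anticanonical_eq_generic_dependent:
  assumes fin: "finite R" "finite (Delta \<inter> lat_M)" and s: "s \<in> R" "s \<in> S" "s \<in> lat_N" "s \<noteq> z"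
    and m0: "m0 \<in> Delta \<inter> lat_M" "m0 \<bullet> z = -1" "m0 \<bullet> s > -1"
  shows "for_generic (Delta \<inter> lat_M) (\<lambda>a.
           \<not> independent_of_coords R S (restrict_to_zero z (anticanonical_eq Delta R a)))"
proof -
  define mon :: "cox_point \<Rightarrow> real^3 \<Rightarrow> complex"
    where "mon p m = (\<Prod>v\<in>R. p v ^ nat \<lfloor>m \<bullet> v + 1\<rfloor>)" for p m
  define p :: cox_point where "p = (\<lambda>_. 1)"
  define q :: cox_point where "q = p(s := 0)"
  \<comment> \<open>Two points differing only in the coordinate of \<open>s\<close>; the equation separates them unless the
    linear form \<open>h\<close> vanishes.\<close>
  define h where "h a = (\<Sum>m\<in>Delta \<inter> lat_M. a m * (mon (p(z := 0)) m - mon (q(z := 0)) m))"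
    for a :: "real^3 \<Rightarrow> complex"
  have h: "h a = restrict_to_zero z (anticanonical_eq Delta R a) p
               - restrict_to_zero z (anticanonical_eq Delta R a) q" for a
    by (simp add: h_def restrict_to_zero_def anticanonical_eq_def mon_def right_diff_distrib
        sum_subtractf)
  have poly: "h \<in> polynomial_functions (Delta \<inter> lat_M)"
    unfolding h_def by (intro linear_form_in_polynomial_functions fin subset_refl)
  \<comment> \<open>With exponent 0 at \<open>z\<close>, the convention \<open>0 ^ 0 = 1\<close>
    keeps the monomial of \<open>m0\<close> alive after the restriction.\<close>
  have "nat \<lfloor>m0 \<bullet> z + 1\<rfloor> = 0"
    by (simp only: m0(2)) simp
  then have "mon (p(z := 0)) m0 = 1"
    unfolding mon_def by (intro prod.neutral) (simp add: p_def)
  moreover have "mon (q(z := 0)) m0 = 0"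
  proof -
    have "m0 \<bullet> s \<in> \<int>"
      using m0 s by (auto intro: inner_lattice_Ints)
    then obtain k where "m0 \<bullet> s = of_int k"
      by (rule Ints_cases)
    with m0(3) have "nat \<lfloor>m0 \<bullet> s + 1\<rfloor> > 0"
      by simp
    then have "(q(z := 0)) s ^ nat \<lfloor>m0 \<bullet> s + 1\<rfloor> = 0"
      using s by (simp add: q_def)
    then show ?thesis
      unfolding mon_def using s fin by (intro prod_zero) blast+
  qed
  \<comment> \<open>Coefficients supported at \<open>m0\<close> isolate its term, so the linear form
    \<open>h\<close> is not identically zero.\<close>
  ultimately have "h (\<lambda>m. if m = m0 then 1 else 0) = 1"
    using m0(1) fin by (simp add: h_def if_distrib[of "\<lambda>x. x * _"] cong: if_cong)
  then have "\<exists>a. h a \<noteq> 0"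
    by (metis zero_neq_one)
  moreover have "\<not> independent_of_coords R S (restrict_to_zero z (anticanonical_eq Delta R a))"
    if "h a \<noteq> 0" for a
  proof
    assume ind: "independent_of_coords R S (restrict_to_zero z (anticanonical_eq Delta R a))"
    have "\<forall>v\<in>R - S. p v = q v"
      using s by (auto simp: q_def)
    with ind have "h a = 0"
      unfolding h independent_of_coords_def by simp
    with that show False ..
  qed
  ultimately show ?thesis
    unfolding for_generic_def using poly by blast
qed

section \<open>The equivalence for generic coefficients\<close>

theorem proposition4p7:
  fixes nabla nabla_phi Delta N_phi R :: "(real^3) set"
    and n_phi v_z v_s v_t :: "real^3"
    and \<Sigma> :: "(real^3) set set"
  assumes "reflexive_polytope lat_N nabla"
    and "Delta = polar_dual lat_N nabla"
    and "n_phi \<in> lat_M" and "(\<lambda>v. n_phi \<bullet> v) ` lat_N = \<int>"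
    and "N_phi = {v \<in> lat_N. n_phi \<bullet> v = 0}"
    and "nabla_phi = nabla \<inter> span N_phi"
    and "reflexive_polytope N_phi nabla_phi"
    and "R = vertices nabla_phi \<union> vertices nabla"
    and "simplicial_fan \<Sigma>" and "projective_fan \<Sigma>"
    and "refines_fan \<Sigma> (face_fan nabla)" and "has_rays \<Sigma> R"
    and "fibred_over_P1 \<Sigma> n_phi"
    and "v_z \<in> vertices nabla_phi"
    and "v_s \<in> vertices nabla - vertices nabla_phi"
    and "v_t \<in> vertices nabla - vertices nabla_phi"
    and "\<exists>E. E edge_of nabla \<and> v_z \<in> E \<and> v_s \<in> E" and "open_segment v_z v_s \<inter> lat_N = {}"
    and "\<exists>E. E edge_of nabla \<and> v_z \<in> E \<and> v_t \<in> E" and "open_segment v_z v_t \<inter> lat_N = {}"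
    and "(n_phi \<bullet> v_s) * (n_phi \<bullet> v_t) < 0"
    and "for_generic (Delta \<inter> lat_M) (\<lambda>a.
           divisor_restricts_to_section \<Sigma> R n_phi (anticanonical_hypersurface \<Sigma> R Delta a) v_z)"
  shows "for_generic (Delta \<inter> lat_M) (\<lambda>a.
           independent_of_coords R {v_s, v_t} (restrict_to_zero v_z (anticanonical_eq Delta R a))
           \<longleftrightarrow> (\<exists>E. E edge_of nabla \<and> v_z \<in> rel_interior E \<and> vertices E = {v_s, v_t}))"
proof -
  note refl = assms(1) and Delta = assms(2) and vz = assms(14) and vs = assms(15) and vt = assms(16)
    and edge_s = assms(17) and edge_t = assms(19)
  have lat: "lattice_polytope lat_N nabla" "lattice_polytope N_phi nabla_phi"
    and latD: "lattice_polytope lat_M Delta" and int0: "0 \<in> rel_interior nabla"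
    using refl assms(7) Delta by (auto simp: reflexive_polytope_def)
  have poly: "polytope nabla"
    using lat(1) by (rule lattice_polytope_imp_polytope)
  have finR: "finite R"
    using lat assms(8) by (simp add: finite_vertices_lattice_polytope)
  have finD: "finite (Delta \<inter> lat_M)"
    using latD by (intro finite_bounded_Int_lat_M polytope_imp_bounded lattice_polytope_imp_polytope)
  have R: "v_z \<in> R" "v_s \<in> R"
    using vz vs assms(8) by auto
  have lat_z: "v_z \<in> lat_N"
    using vertices_lattice_polytope[OF lat(2)] vz assms(5) by auto
  have lat_s: "v_s \<in> lat_N"
    using vertices_lattice_polytope[OF lat(1)] vs by auto
  \<comment> \<open>If \<open>v_s = v_t\<close>, the product of their heights, assumed negative,
    would be a square.\<close>
  have neq: "v_s \<noteq> v_z" "v_s \<noteq> v_t"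
    using vz vs assms(21) by (auto simp: zero_le_square not_less[symmetric])
  have ge: "m \<bullet> v \<ge> -1" if "m \<in> Delta" "v \<in> nabla" for m v
    using that Delta by (auto simp: polar_dual_def)
  have in_nabla: "v_z \<in> nabla" "v_s \<in> nabla" "v_t \<in> nabla"
    using edge_s edge_t by (auto simp: edge_of_def dest: face_of_imp_subset)
  show ?thesis
  \<comment> \<open>The edge condition does not involve \<open>a\<close>: it suffices to prove
    independence for all \<open>a\<close> when it holds, and dependence for generic \<open>a\<close>
    when it fails.\<close>
  proof (cases "\<exists>E. E edge_of nabla \<and> v_z \<in> rel_interior E \<and> vertices E = {v_s, v_t}")
    case True
    then obtain E where E: "E edge_of nabla" "v_z \<in> rel_interior E" "vertices E = {v_s, v_t}"
      by blast
    obtain a b where "a \<noteq> b" "E = closed_segment a b"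
      using edge_of_polytope_closed_segment[OF poly E(1)] by blast
    with E have "v_z \<in> open_segment a b" "{a, b} = {v_s, v_t}"
      using vertices_closed_segment[of a b] by (auto simp: rel_interior_closed_segment)
    then have "v_z \<in> open_segment v_s v_t"
      by (metis doubleton_eq_iff open_segment_commute)
    then obtain c where c: "0 < c" "c < 1" "v_z = (1 - c) *\<^sub>R v_s + c *\<^sub>R v_t"
      by (auto simp: in_segment)
    \<comment> \<open>The affine function \<open>m \<bullet> x + 1\<close> is non-negative on
      \<open>nabla\<close>; vanishing at a proper convex combination forces it to vanish at both
      endpoints.\<close>
    have min: "m \<bullet> v = -1"
      if m: "m \<in> Delta \<inter> lat_M" "m \<bullet> v_z = -1" and v: "v \<in> {v_s, v_t}" for m v
    proof -
      have "(1 - c) * (m \<bullet> v_s + 1) + c * (m \<bullet> v_t + 1) = 0"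
        using m(2) by (simp add: c(3) inner_add_right algebra_simps)
      moreover have "(1 - c) * (m \<bullet> v_s + 1) \<ge> 0" "c * (m \<bullet> v_t + 1) \<ge> 0"
        using c ge[of m v_s] ge[of m v_t] m in_nabla by auto
      ultimately have "(1 - c) * (m \<bullet> v_s + 1) = 0" "c * (m \<bullet> v_t + 1) = 0"
        by linarith+
      then show ?thesis
        using c v by auto
    qed
    have "independent_of_coords R {v_s, v_t} (restrict_to_zero v_z (anticanonical_eq Delta R a))" for a
      using finR R lat_z ge in_nabla min by (intro restricted_anticanonical_eq_independent) auto
    with True show ?thesis
      unfolding for_generic_def
      by (intro bexI[of _ "\<lambda>_. 1"] polynomial_functions.const) auto
  next
    case False
    \<comment> \<open>Otherwise the edges from \<open>v_z\<close> to \<open>v_s\<close> and to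
      \<open>v_t\<close> would be one edge with \<open>v_z\<close> in its interior, which this case
      excludes.\<close>
    have "v_z \<in> vertices nabla"
    proof (rule ccontr)
      assume nv: "v_z \<notin> vertices nabla"
      obtain E E' where "E edge_of nabla" "v_z \<in> E" "v_s \<in> E" "E' edge_of nabla" "v_z \<in> E'" "v_t \<in> E'"
        using edge_s edge_t by blast
      with nonvertex_in_rel_interior_edge[OF poly this _ _ neq(2) nv] vs vt False show False
        by blast
    qed
    then obtain u where u: "u \<in> Delta" "u \<bullet> v_z = -1" "u \<bullet> v_s > -1"
      using polar_dual_exposes_vertex[OF poly int0 span_lat_N _ in_nabla(2) neq(1)] Delta by blast
    \<comment> \<open>The point \<open>u\<close> need not be a lattice point; it is replaced by one
      of the lattice points generating \<open>Delta\<close>.\<close>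
    obtain S where S: "finite S" "S \<subseteq> lat_M" "Delta = convex hull S"
      using latD by (auto simp: lattice_polytope_def)
    then have "S \<subseteq> Delta"
      by (simp add: hull_subset)
    then obtain m where "m \<in> S" "m \<bullet> v_z = -1" "m \<bullet> v_s > -1"
      using convex_hull_minimum_attained_off[OF S(1), of u "-1" v_z "-1" v_s] u S(3) ge in_nabla
      by blast
    with \<open>S \<subseteq> Delta\<close> S(2) have "for_generic (Delta \<inter> lat_M) (\<lambda>a. \<not> independent_of_coords R {v_s, v_t}
        (restrict_to_zero v_z (anticanonical_eq Delta R a)))"
      using finR finD R lat_s neq
      by (intro restricted_anticanonical_eq_generic_dependent[of R Delta v_s _ v_z m]) auto
    then show ?thesis
      by (simp only: False simp_thms)
  qed
qed

end
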